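(* If $H$ and $K$ are isomorphic numerical semigroups, then $H=K$.
   Context: $\mathbb N=\{0,1,2,\ldots\}$. A numerical semigroup is a submonoid $H$ of $(\mathbb N,+)$ such that $\mathbb N\setminus H$ is finite. Two numerical semigroups $H,K$ are isomorphic if there is a bijection $\varphi:H\to K$ with $\varphi(a+b)=\varphi(a)+\varphi(b)$ for all $a,b\in H$. *)

theory Defs
  imports Main
begin

definition numerical_semigroup :: "nat set \<Rightarrow> bool" where
  "numerical_semigroup H \<longleftrightarrow>
     0 \<in> H \<and> (\<forall>a\<in>H. \<forall>b\<in>H. a + b \<in> H) \<and> finite (UNIV - H)"

definition isomorphic_ns :: "nat set \<Rightarrow> nat set \<Rightarrow> bool" where
  "isomorphic_ns H K \<longleftrightarrow>
     (\<exists>\<phi> :: nat \<Rightarrow> nat. bij_betw \<phi> H K \<and> (\<forall>a\<in>H. \<forall>b\<in>H. \<phi> (a + b) = \<phi> a + \<phi> b))"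

end

theory Submission
  imports Defs
begin

text \<open>
  An additive map \<open>\<phi>\<close> on a numerical semigroup \<open>H\<close> is a dilation: evaluating \<open>\<phi> (a * b)\<close>
  both as a multiple of \<open>\<phi> a\<close> and as a multiple of \<open>\<phi> b\<close> shows that the ratio \<open>\<phi> a / a\<close> does
  not depend on \<open>a \<noteq> 0\<close>. This ratio is a natural number \<open>m\<close>, because \<open>H\<close> contains two
  consecutive integers and these are coprime (\<open>additive_map_is_dilation\<close>). An isomorphism
  from \<open>H\<close> to \<open>K\<close> therefore exhibits \<open>K\<close> as the set of all \<open>m\<close>-fold multiples of elements
  of \<open>H\<close>. As \<open>K\<close> contains two consecutive integers as well, \<open>m\<close> divides \<open>1\<close>, and \<open>K = H\<close>.
\<close>

lemma numerical_semigroup_consecutive: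
  assumes "numerical_semigroup H"
  obtains c where "c > 0" "c \<in> H" "Suc c \<in> H"
proof -
  from assms obtain N where N: "\<And>n. n \<notin> H \<Longrightarrow> n < N"
    unfolding numerical_semigroup_def finite_nat_set_iff_bounded by blast
  have "Suc N \<in> H" "Suc (Suc N) \<in> H"
    using N[of "Suc N"] N[of "Suc (Suc N)"] by auto
  then show thesis
    using that[of "Suc N"] by simp
qed

lemma additive_map_multiple:
  fixes \<phi> :: "nat \<Rightarrow> nat"
  assumes "numerical_semigroup H"
    and add: "\<And>a b. a \<in> H \<Longrightarrow> b \<in> H \<Longrightarrow> \<phi> (a + b) = \<phi> a + \<phi> b"
    and "a \<in> H"
  shows "n * a \<in> H \<and> \<phi> (n * a) = n * \<phi> a"
proof (induction n)
  case 0
  have "0 \<in> H"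
    using assms(1) by (simp add: numerical_semigroup_def)
  with add[of 0 0] show ?case by simp
next
  case (Suc n)
  with assms show ?case
    by (simp add: numerical_semigroup_def)
qed

text \<open>
  Over the rationals the common ratio exists for every additive map; the consecutive
  elements \<open>c\<close> and \<open>c + 1\<close> make it integral, since \<open>c * \<phi> (c + 1) = (c + 1) * \<phi> c\<close> forces
  \<open>c\<close> to divide \<open>\<phi> c\<close>.
\<close>

lemma additive_map_is_dilation:
  fixes \<phi> :: "nat \<Rightarrow> nat"
  assumes H: "numerical_semigroup H"
    and add: "\<And>a b. a \<in> H \<Longrightarrow> b \<in> H \<Longrightarrow> \<phi> (a + b) = \<phi> a + \<phi> b"
  obtains m where "\<And>a. a \<in> H \<Longrightarrow> \<phi> a = m * a"
proof -
  have cross: "a * \<phi> b = b * \<phi> a" if "a \<in> H" "b \<in> H" for a b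
  proof -
    have "\<phi> (a * b) = a * \<phi> b"
      using additive_map_multiple[OF H add \<open>b \<in> H\<close>] by simp
    moreover have "\<phi> (b * a) = b * \<phi> a"
      using additive_map_multiple[OF H add \<open>a \<in> H\<close>] by simp
    ultimately show ?thesis
      by (simp add: mult.commute)
  qed
  obtain c where c: "c > 0" "c \<in> H" "Suc c \<in> H"
    using numerical_semigroup_consecutive[OF H] .
  have "c * \<phi> (Suc c) = c * \<phi> c + \<phi> c"
    using cross[OF c(2,3)] by simp
  then have "c dvd c * \<phi> c + \<phi> c"
    by (metis dvd_triv_left)
  then have "c dvd \<phi> c"
    by (simp add: dvd_add_right_iff)
  then obtain m where m: "\<phi> c = c * m" ..
  have "\<phi> a = m * a" if "a \<in> H" for a
  proof -
    have "c * \<phi> a = c * (m * a)"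
      using cross[OF c(2) that] m by (simp add: ac_simps)
    with c(1) show ?thesis by simp
  qed
  then show thesis by (rule that)
qed

theorem theorem4p3:
  fixes H K :: "nat set"
  assumes "numerical_semigroup H"
    and "numerical_semigroup K"
    and "isomorphic_ns H K"
  shows "H = K"
proof -
  obtain \<phi> :: "nat \<Rightarrow> nat" where bij: "bij_betw \<phi> H K"
    and add: "\<And>a b. a \<in> H \<Longrightarrow> b \<in> H \<Longrightarrow> \<phi> (a + b) = \<phi> a + \<phi> b"
    using assms(3) by (auto simp: isomorphic_ns_def)
  obtain m where m: "\<And>a. a \<in> H \<Longrightarrow> \<phi> a = m * a"
    using additive_map_is_dilation[OF assms(1) add] by blast
  have K: "K = (\<lambda>a. m * a) ` H"
    using bij m by (auto simp: bij_betw_def)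
  obtain d where "d \<in> K" "Suc d \<in> K"
    using numerical_semigroup_consecutive[OF assms(2)] by blast
  then have "m dvd d" "m dvd Suc d"
    by (auto simp: K)
  then have "m dvd Suc d - d"
    by (intro dvd_diff_nat)
  then have "m = 1" by simp
  with K show ?thesis by simp
qed

end
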